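(* Let $G$ be a topological group, $H\le G$ an open subgroup coarsely bounded in $G$, and $S=\{s_1,s_2,\dots\}\subset G$ a countably infinite set such that $G$ is generated by $H\cup S$ and such that, for each $k\geq 1$, $G_k=\langle H,s_1,\dots,s_k\rangle$ is a proper subgroup of $G$. Let $\Gamma$ be the associated tree of Cayley--Abels--Rosendal graphs for $G$. If $v\in\Gamma$ is a vertex, then the orbit map $g\mapsto g.v$ from the action of $G$ on $\Gamma$ is a coarse equivalence between $G$ with its canonical coarse structure and the orbit $G.v$ equipped with the subspace metric.
   Context: Tree of Cayley--Abels--Rosendal graphs: given $G$, $H$, $S=\{s_1,s_2,\dots\}$ as in the claim, $\Gamma$ is the graph with vertex set $(G/H)\times\{1,2,3,\dots\}$ and the following edges. Vertical edges: $(gH,k)$ is joined to $(gH,k+1)$ for every coset $gH$ and every $k\ge1$. Horizontal edges: $(fH,k)$ is joined to every vertex of the form $(fhs_iH,k)$ with $h\in H$ and $1\le i\le k$. The group $G$ acts on $\Gamma$ by $g.(fH,k)=(gfH,k)$. The graph $\Gamma$ carries its graph metric (edges of length $1$), and $G.v$ the restricted metric. Canonical (left-)coarse structure of a topological group $G$: $E\subset G\times G$ is an entourage iff $\sup_{(g,h)\in E}d(g,h)<\infty$ for every continuous left-invariant pseudometric $d$ on $G$. A subset $A\subset G$ is coarsely bounded in $G$ if it has finite diameter in every continuous left-invariant pseudometric on $G$. A map between coarse spaces is a coarse equivalence if it is bornologous (images of entourages are entourages), expanding (preimages of entourages are entourages) and cobounded (there is an entourage $E$ of the target such that every point of the target is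 $E$-related to a point of the image). A metric space carries the coarse structure whose entourages are the sets of pairs on which the metric is bounded. *)

theory Defs
  imports "HOL-Analysis.Analysis" "HOL-Library.Extended_Nat"
    "HOL-Algebra.Generated_Groups" "HOL-Algebra.Left_Coset" "HOL-Algebra.Group_Action"
begin

section \<open>Topological groups and their left-coarse structure\<close>

text \<open>No separation axiom is imposed on a topological group.\<close>

locale topological_group = group G for G (structure) +
  fixes T :: "'a topology"
  assumes topspace_eq: "topspace T = carrier G"
    and continuous_mult: "continuous_map (prod_topology T T) T (\<lambda>(x, y). x \<otimes> y)"
    and continuous_inv: "continuous_map T T (\<lambda>x. inv x)"

definition left_inv_pseudometric ::
    "('a, 'b) monoid_scheme \<Rightarrow> 'a topology \<Rightarrow> ('a \<Rightarrow> 'a \<Rightarrow> real) \<Rightarrow> bool" where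
  "left_inv_pseudometric G T d \<longleftrightarrow>
     (\<forall>x\<in>carrier G. \<forall>y\<in>carrier G. 0 \<le> d x y) \<and>
     (\<forall>x\<in>carrier G. d x x = 0) \<and>
     (\<forall>x\<in>carrier G. \<forall>y\<in>carrier G. d x y = d y x) \<and>
     (\<forall>x\<in>carrier G. \<forall>y\<in>carrier G. \<forall>z\<in>carrier G. d x z \<le> d x y + d y z) \<and>
     (\<forall>g\<in>carrier G. \<forall>x\<in>carrier G. \<forall>y\<in>carrier G. d (g \<otimes>\<^bsub>G\<^esub> x) (g \<otimes>\<^bsub>G\<^esub> y) = d x y) \<and>
     continuous_map (prod_topology T T) euclideanreal (\<lambda>(x, y). d x y)"

definition coarsely_bounded ::
    "('a, 'b) monoid_scheme \<Rightarrow> 'a topology \<Rightarrow> 'a set \<Rightarrow> bool" where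
  "coarsely_bounded G T A \<longleftrightarrow> A \<subseteq> carrier G \<and>
     (\<forall>d. left_inv_pseudometric G T d \<longrightarrow> bdd_above ((\<lambda>(x, y). d x y) ` (A \<times> A)))"

definition left_entourages ::
    "('a, 'b) monoid_scheme \<Rightarrow> 'a topology \<Rightarrow> ('a \<times> 'a) set set" where
  "left_entourages G T = {E. E \<subseteq> carrier G \<times> carrier G \<and>
     (\<forall>d. left_inv_pseudometric G T d \<longrightarrow> bdd_above ((\<lambda>(g, h). d g h) ` E))}"


section \<open>Metric coarse structures and coarse equivalences\<close>

text \<open>Distances take values in the extended naturals, so that points in different
  components of a graph are at distance \<open>\<infinity>\<close>; a set of pairs is an entourage iff
  the distance is bounded on it by a finite number.\<close>

definition metric_entourages :: "'v set \<Rightarrow> ('v \<Rightarrow> 'v \<Rightarrow> enat) \<Rightarrow> ('v \<times> 'v) set set" where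
  "metric_entourages Y d = {F. F \<subseteq> Y \<times> Y \<and> (\<exists>n::nat. \<forall>(x, y)\<in>F. d x y \<le> enat n)}"

definition bornologous ::
    "('x \<times> 'x) set set \<Rightarrow> ('y \<times> 'y) set set \<Rightarrow> ('x \<Rightarrow> 'y) \<Rightarrow> bool" where
  "bornologous \<E> \<F> f \<longleftrightarrow> (\<forall>E\<in>\<E>. map_prod f f ` E \<in> \<F>)"

definition expanding ::
    "'x set \<Rightarrow> ('x \<times> 'x) set set \<Rightarrow> ('y \<times> 'y) set set \<Rightarrow> ('x \<Rightarrow> 'y) \<Rightarrow> bool" where
  "expanding X \<E> \<F> f \<longleftrightarrow> (\<forall>F\<in>\<F>. map_prod f f -` F \<inter> (X \<times> X) \<in> \<E>)"

definition cobounded :: "'x set \<Rightarrow> 'y set \<Rightarrow> ('y \<times> 'y) set set \<Rightarrow> ('x \<Rightarrow> 'y) \<Rightarrow> bool" where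
  "cobounded X Y \<F> f \<longleftrightarrow> (\<exists>F\<in>\<F>. \<forall>y\<in>Y. \<exists>x\<in>X. (y, f x) \<in> F)"

definition coarse_equivalence ::
    "'x set \<Rightarrow> ('x \<times> 'x) set set \<Rightarrow> 'y set \<Rightarrow> ('y \<times> 'y) set set \<Rightarrow> ('x \<Rightarrow> 'y) \<Rightarrow> bool" where
  "coarse_equivalence X \<E> Y \<F> f \<longleftrightarrow>
     f \<in> X \<rightarrow> Y \<and> bornologous \<E> \<F> f \<and> expanding X \<E> \<F> f \<and> cobounded X Y \<F> f"


section \<open>The tree of Cayley--Abels--Rosendal graphs\<close>

text \<open>A graph is given by its symmetric adjacency relation \<open>R\<close>; \<open>R ^^ n\<close> relates the
  endpoints of walks of length \<open>n\<close>.\<close>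

definition graph_dist :: "('v \<times> 'v) set \<Rightarrow> 'v \<Rightarrow> 'v \<Rightarrow> enat" where
  "graph_dist R u v = (INF n\<in>{n. (u, v) \<in> R ^^ n}. enat n)"

text \<open>Sequences \<open>s\<close> enumerating \<open>S\<close> are indexed from \<open>1\<close>; the value \<open>s 0\<close> is never used.\<close>

definition tree_verts :: "('a, 'b) monoid_scheme \<Rightarrow> 'a set \<Rightarrow> ('a set \<times> nat) set" where
  "tree_verts G H = (lcosets\<^bsub>G\<^esub> H) \<times> {1..}"

definition vertical_edges ::
    "('a, 'b) monoid_scheme \<Rightarrow> 'a set \<Rightarrow> (('a set \<times> nat) \<times> ('a set \<times> nat)) set" where
  "vertical_edges G H =
     {((g <#\<^bsub>G\<^esub> H, k), (g <#\<^bsub>G\<^esub> H, k + 1)) | g k. g \<in> carrier G \<and> 1 \<le> k}"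

definition horizontal_edges ::
    "('a, 'b) monoid_scheme \<Rightarrow> 'a set \<Rightarrow> (nat \<Rightarrow> 'a) \<Rightarrow>
     (('a set \<times> nat) \<times> ('a set \<times> nat)) set" where
  "horizontal_edges G H s =
     {((f <#\<^bsub>G\<^esub> H, k), ((f \<otimes>\<^bsub>G\<^esub> h \<otimes>\<^bsub>G\<^esub> s i) <#\<^bsub>G\<^esub> H, k)) | f h i k.
        f \<in> carrier G \<and> h \<in> H \<and> 1 \<le> i \<and> i \<le> k}"

definition tree_adj ::
    "('a, 'b) monoid_scheme \<Rightarrow> 'a set \<Rightarrow> (nat \<Rightarrow> 'a) \<Rightarrow>
     (('a set \<times> nat) \<times> ('a set \<times> nat)) set" where
  "tree_adj G H s =
     (let R = vertical_edges G H \<union> horizontal_edges G H s in R \<union> R\<inverse>)"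

text \<open>The restriction to the vertex set makes the maps extensional, as the
  locale \<open>group_action\<close> requires.\<close>

definition tree_act ::
    "('a, 'b) monoid_scheme \<Rightarrow> 'a set \<Rightarrow> 'a \<Rightarrow> ('a set \<times> nat) \<Rightarrow> ('a set \<times> nat)" where
  "tree_act G H g = restrict (\<lambda>(C, k). (g <#\<^bsub>G\<^esub> C, k)) (tree_verts G H)"

end

theory Submission
  imports Defs
begin

text \<open>
  Since \<open>H\<close> is open, the distance between orbit points is a locally constant, hence continuous,
  left-invariant pseudometric on \<open>G\<close>, so the orbit map is bornologous. Conversely a walk of
  length \<open>n\<close> from level \<open>k\<close> stays below level \<open>k + n\<close>, so its horizontal edges only
  involve \<open>s 1, \<dots>, s (k + n)\<close>; each edge then moves the elements of the cosets a bounded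
  amount with respect to any given continuous left-invariant pseudometric, because \<open>H\<close> is
  coarsely bounded.
\<close>

no_notation subset_mset (infix "<#" 50)

section \<open>Walks and distances in graphs\<close>

text \<open>The infimum over no walks is infinite, so a finite bound forces a walk to exist; an
  infimum over a nonempty set of naturals is attained. This translates distance bounds into
  walks.\<close>

lemma graph_dist_le_iff: "graph_dist R u v \<le> enat n \<longleftrightarrow> (\<exists>m\<le>n. (u, v) \<in> R ^^ m)"
proof
  assume le: "graph_dist R u v \<le> enat n"
  let ?A = "enat ` {m. (u, v) \<in> R ^^ m}"
  have "?A \<noteq> {}"
    using le by (auto simp: graph_dist_def top_enat_def simp del: image_is_empty)
  then have "Inf ?A \<in> ?A"
    by (metis Inf_enat_def LeastI_ex ex_in_conv)
  then obtain m where "(u, v) \<in> R ^^ m" "Inf ?A = enat m"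
    by blast
  with le show "\<exists>m\<le>n. (u, v) \<in> R ^^ m"
    by (auto simp: graph_dist_def)
next
  assume "\<exists>m\<le>n. (u, v) \<in> R ^^ m"
  then obtain m where m: "m \<le> n" "(u, v) \<in> R ^^ m"
    by blast
  then have "graph_dist R u v \<le> enat m"
    unfolding graph_dist_def by (intro INF_lower) simp
  with m show "graph_dist R u v \<le> enat n"
    by (meson enat_ord_simps(1) order_trans)
qed

lemma graph_dist_finite_iff: "graph_dist R u v \<noteq> \<infinity> \<longleftrightarrow> (u, v) \<in> R\<^sup>*"
  by (metis graph_dist_le_iff not_infinity_eq order_refl rtrancl_power
      enat_ord_simps(5))

lemma graph_dist_refl: "graph_dist R u u = 0"
proof -
  have "graph_dist R u u \<le> enat 0"
    unfolding graph_dist_le_iff by auto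
  then show ?thesis
    by (simp add: zero_enat_def[symmetric])
qed

lemma enat_le_if_bounds: "(\<And>n. b \<le> enat n \<Longrightarrow> a \<le> enat n) \<Longrightarrow> a \<le> (b::enat)"
  by (cases b) auto

lemma graph_dist_triangle: "graph_dist R u w \<le> graph_dist R u v + graph_dist R v w"
proof (cases "graph_dist R u v"; cases "graph_dist R v w")
  fix m n assume mn: "graph_dist R u v = enat m" "graph_dist R v w = enat n"
  then obtain m' n' where "m' \<le> m" "(u, v) \<in> R ^^ m'" "n' \<le> n" "(v, w) \<in> R ^^ n'"
    by (metis graph_dist_le_iff order_refl)
  then have "(u, w) \<in> R ^^ (m' + n')" "m' + n' \<le> m + n"
    by (auto simp: relpow_add)
  then have "graph_dist R u w \<le> enat (m + n)"
    using graph_dist_le_iff by metis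
  then show ?thesis
    by (simp add: mn)
qed auto

lemma relpow_map:
  assumes "\<And>u v. (u, v) \<in> R \<Longrightarrow> (\<phi> u, \<phi> v) \<in> R'" and "(u, v) \<in> R ^^ n"
  shows "(\<phi> u, \<phi> v) \<in> R' ^^ n"
  using assms(2) by (induction n arbitrary: v) (auto dest: assms(1))

text \<open>A map preserving adjacency sends walks to walks of the same length. Left translations of
  the tree of graphs are the intended case.\<close>

lemma graph_dist_map_le:
  assumes "\<And>u v. (u, v) \<in> R \<Longrightarrow> (\<phi> u, \<phi> v) \<in> R'"
  shows "graph_dist R' (\<phi> u) (\<phi> v) \<le> graph_dist R u v"
proof (rule enat_le_if_bounds)
  fix n assume "graph_dist R u v \<le> enat n"
  then show "graph_dist R' (\<phi> u) (\<phi> v) \<le> enat n"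
    unfolding graph_dist_le_iff using relpow_map[of R \<phi> R', OF assms] by blast
qed

lemma relpow_sym: "sym R \<Longrightarrow> (u, v) \<in> R ^^ n \<Longrightarrow> (v, u) \<in> R ^^ n"
proof (induction n arbitrary: v)
  case (Suc n)
  then obtain w where "(u, w) \<in> R ^^ n" "(w, v) \<in> R"
    by auto
  with Suc show ?case
    by (meson relpow_Suc_I2 symD)
qed auto

lemma graph_dist_sym:
  assumes "sym R"
  shows "graph_dist R u v = graph_dist R v u"
  unfolding graph_dist_def using relpow_sym[OF assms] by (intro arg_cong[where f = Inf]) auto

section \<open>Cosets and edges of the tree of graphs\<close>

text \<open>Generation of the group and coarse boundedness of \<open>H\<close> are assumed
  separately, in the results that call for them.\<close>

locale tree_of_graphs = topological_group G T for G (structure) and T :: "'a topology" +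
  fixes H :: "'a set" and s :: "nat \<Rightarrow> 'a"
  assumes subgroup_H: "subgroup H G"
    and openin_H: "openin T H"
    and s_closed: "1 \<le> i \<Longrightarrow> s i \<in> carrier G"
begin

abbreviation adj where "adj \<equiv> tree_adj G H s"

lemma H_sub: "H \<subseteq> carrier G"
  by (rule subgroup.subset[OF subgroup_H])

lemma sym_adj: "sym adj"
  unfolding tree_adj_def Let_def sym_def by blast

lemma translate_lcoset:
  "g \<in> carrier G \<Longrightarrow> f \<in> carrier G \<Longrightarrow> g <# (f <# H) = (g \<otimes> f) <# H"
  by (simp add: lcos_m_assoc H_sub)

lemma lcoset_eqI:
  assumes "x \<in> carrier G" "y \<in> carrier G" "inv x \<otimes> y \<in> H"
  shows "x <# H = y <# H"
proof -
  have "y = x \<otimes> (inv x \<otimes> y)"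
    using assms by (simp add: m_assoc[symmetric])
  then have "y \<in> x <# H"
    unfolding l_coset_def using assms(3) by blast
  then show ?thesis
    by (metis assms(1) l_repr_independence subgroup_H)
qed

lemma lcoset_mult_H: "x \<in> carrier G \<Longrightarrow> h \<in> H \<Longrightarrow> (x \<otimes> h) <# H = x <# H"
  using H_sub by (intro lcoset_eqI[symmetric]) (auto simp: m_assoc[symmetric])

lemma vertical_adj: "f \<in> carrier G \<Longrightarrow> 1 \<le> k \<Longrightarrow> ((f <# H, k), (f <# H, k + 1)) \<in> adj"
  unfolding tree_adj_def Let_def vertical_edges_def by blast

lemma horizontal_adj:
  assumes "f \<in> carrier G" "1 \<le> i" "i \<le> k"
  shows "((f <# H, k), ((f \<otimes> s i) <# H, k)) \<in> adj"
proof -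
  have "\<exists>f' h i' k'. ((f <# H, k), ((f \<otimes> s i) <# H, k)) =
          ((f' <# H, k'), ((f' \<otimes> h \<otimes> s i') <# H, k')) \<and>
          f' \<in> carrier G \<and> h \<in> H \<and> 1 \<le> i' \<and> i' \<le> k'"
    using assms subgroup.one_closed[OF subgroup_H]
    by (intro exI[of _ f] exI[of _ \<one>] exI[of _ i] exI[of _ k]) simp
  then show ?thesis
    unfolding tree_adj_def Let_def horizontal_edges_def by blast
qed

text \<open>Edge data \<open>f\<close>, \<open>h\<close>, \<open>i\<close>, \<open>k\<close> become
  \<open>g \<otimes> f\<close>, \<open>h\<close>, \<open>i\<close>, \<open>k\<close>. The total map
  stands in for the restricted \<open>tree_act\<close>, so that membership in
  \<open>tree_verts\<close> need not be tracked.\<close>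

lemma translate_adj:
  assumes g: "g \<in> carrier G" and uv: "(u, v) \<in> adj"
  shows "(map_prod (\<lambda>C. g <# C) id u, map_prod (\<lambda>C. g <# C) id v) \<in> adj"
proof -
  let ?\<phi> = "map_prod (\<lambda>C. g <# C) id"
  let ?V = "vertical_edges G H" and ?Z = "horizontal_edges G H s"
  have v: "(?\<phi> u, ?\<phi> v) \<in> ?V" if uv: "(u, v) \<in> ?V" for u v
  proof -
    obtain f k where "u = (f <# H, k)" "v = (f <# H, k + 1)" "f \<in> carrier G" "1 \<le> k"
      using uv unfolding vertical_edges_def by blast
    then show ?thesis
      unfolding vertical_edges_def using g by (auto simp: translate_lcoset)
  qed
  have h: "(?\<phi> u, ?\<phi> v) \<in> ?Z" if uv: "(u, v) \<in> ?Z" for u v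
  proof -
    obtain f h i k where *: "u = (f <# H, k)" "v = ((f \<otimes> h \<otimes> s i) <# H, k)"
      "f \<in> carrier G" "h \<in> H" "1 \<le> i" "i \<le> k"
      using uv unfolding horizontal_edges_def by blast
    then have "?\<phi> u = ((g \<otimes> f) <# H, k)" "?\<phi> v = ((g \<otimes> f \<otimes> h \<otimes> s i) <# H, k)"
      using g s_closed H_sub by (auto simp: translate_lcoset m_assoc)
    then show ?thesis
      unfolding horizontal_edges_def using * g by blast
  qed
  show ?thesis
    using uv v h unfolding tree_adj_def Let_def by blast
qed

section \<open>Connectedness within a level\<close>

lemma vertical_connected:
  assumes "f \<in> carrier G" "1 \<le> k"
  shows "((f <# H, k), (f <# H, k + j)) \<in> adj\<^sup>*"
proof (induction j)
  case (Suc j)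
  have "((f <# H, k + j), (f <# H, (k + j) + 1)) \<in> adj"
    using assms by (intro vertical_adj) auto
  with Suc show ?case
    by (simp add: rtrancl.rtrancl_into_rtrancl)
qed simp

lemma connected_sym: "(u, v) \<in> adj\<^sup>* \<Longrightarrow> (v, u) \<in> adj\<^sup>*"
  using sym_rtrancl[OF sym_adj] by (rule symD)

text \<open>An element of \<open>H\<close> leaves the coset unchanged. For \<open>s i\<close> there
  may be no edge at level \<open>k\<close>, namely if \<open>k < i\<close>, so the walk climbs to
  level \<open>k + i\<close>, crosses there and descends.\<close>

lemma generator_connected:
  assumes x: "x \<in> H \<union> s ` {1..}" and f: "f \<in> carrier G" and k: "1 \<le> k"
  shows "((f <# H, k), ((f \<otimes> x) <# H, k)) \<in> adj\<^sup>*"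
  using x
proof
  assume "x \<in> H"
  then show ?thesis
    by (simp add: lcoset_mult_H f)
next
  assume "x \<in> s ` {1..}"
  then obtain i where i: "1 \<le> i" "x = s i"
    by auto
  have "((f <# H, k), (f <# H, k + i)) \<in> adj\<^sup>*"
    using f k by (rule vertical_connected)
  also have "((f <# H, k + i), ((f \<otimes> x) <# H, k + i)) \<in> adj"
    unfolding i(2) using f i(1) by (intro horizontal_adj) auto
  also have "(((f \<otimes> x) <# H, k + i), ((f \<otimes> x) <# H, k)) \<in> adj\<^sup>*"
    by (rule connected_sym, rule vertical_connected) (use f k i s_closed in auto)
  finally show ?thesis .
qed

text \<open>A word is traversed factor by factor from the left; each factor starts at a new coset,
  hence the induction is uniform in \<open>f\<close>.\<close>

lemma generate_connected:
  assumes "x \<in> generate G (H \<union> s ` {1..})" and "f \<in> carrier G" and k: "1 \<le> k"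
  shows "((f <# H, k), ((f \<otimes> x) <# H, k)) \<in> adj\<^sup>*"
proof -
  have K: "H \<union> s ` {1..} \<subseteq> carrier G"
    using H_sub s_closed by auto
  show ?thesis
    using assms(1,2)
  proof (induction arbitrary: f)
    case one
    then show ?case
      by simp
  next
    case (incl h)
    then show ?case
      using k by (intro generator_connected)
  next
    case (inv h)
    have h: "h \<in> carrier G"
      using inv(1) K by blast
    \<comment> \<open>An inverse generator is a generator walk traversed backwards: multiplying
      \<open>f \<otimes> inv h\<close> by \<open>h\<close> leads back to \<open>f\<close>.\<close>
    have "(((f \<otimes> inv h) <# H, k), ((f \<otimes> inv h \<otimes> h) <# H, k)) \<in> adj\<^sup>*"
      using k inv h by (intro generator_connected) auto
    then show ?case
      using inv(2) h by (simp add: m_assoc connected_sym)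
  next
    case (eng h1 h2)
    have h: "h1 \<in> carrier G" "h2 \<in> carrier G"
      using eng(1,2) generate_in_carrier[OF K] by auto
    have "((f <# H, k), ((f \<otimes> h1) <# H, k)) \<in> adj\<^sup>*"
      using eng by blast
    also have "(((f \<otimes> h1) <# H, k), ((f \<otimes> h1 \<otimes> h2) <# H, k)) \<in> adj\<^sup>*"
      using eng h by blast
    finally show ?case
      using h eng by (simp add: m_assoc)
  qed
qed

section \<open>The orbit distance as a continuous left-invariant pseudometric\<close>

text \<open>Connectedness makes the distance finite, translations of the graph make it
  left-invariant, and openness of \<open>H\<close> makes it continuous. The second claim carries
  real bounds back to \<open>graph_dist\<close>.\<close>

lemma orbit_pseudometric:
  assumes gen: "generate G (H \<union> s ` {1..}) = carrier G"
    and f: "f \<in> carrier G" and k: "1 \<le> k"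
  defines "p \<equiv> \<lambda>x. ((x \<otimes> f) <# H, k)"
  defines "d \<equiv> \<lambda>x y. real (the_enat (graph_dist adj (p x) (p y)))"
  shows "left_inv_pseudometric G T d"
    and "x \<in> carrier G \<Longrightarrow> y \<in> carrier G \<Longrightarrow> d x y \<le> real n \<Longrightarrow> graph_dist adj (p x) (p y) \<le> enat n"
proof -
  have conn: "(p x, p y) \<in> adj\<^sup>*" if "x \<in> carrier G" "y \<in> carrier G" for x y
  proof -
    have c: "x \<otimes> f \<in> carrier G" "y \<otimes> f \<in> carrier G"
      using that f by auto
    \<comment> \<open>The quotient of the two representatives lies in the generated subgroup, since
      this is the whole group.\<close>
    have "((x \<otimes> f <# H, k), ((x \<otimes> f) \<otimes> (inv (x \<otimes> f) \<otimes> (y \<otimes> f)) <# H, k)) \<in> adj\<^sup>*"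
      using c k by (intro generate_connected) (simp_all only: gen m_closed inv_closed)
    also have "(x \<otimes> f) \<otimes> (inv (x \<otimes> f) \<otimes> (y \<otimes> f)) = y \<otimes> f"
      using c by (simp add: m_assoc[symmetric])
    finally show ?thesis
      by (simp add: p_def)
  qed
  \<comment> \<open>\<open>the_enat\<close> is unspecified at infinity; connectedness excludes that
    value.\<close>
  have enat_dist: "enat (the_enat (graph_dist adj (p x) (p y))) = graph_dist adj (p x) (p y)"
    if "x \<in> carrier G" "y \<in> carrier G" for x y
    using conn[OF that] by (simp flip: graph_dist_finite_iff) auto
  show "graph_dist adj (p x) (p y) \<le> enat n"
    if "x \<in> carrier G" "y \<in> carrier G" "d x y \<le> real n" for x y
    using that enat_dist[OF that(1,2)] unfolding d_def
    by (metis enat_ord_simps(1) of_nat_le_iff)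
  have tri: "d x z \<le> d x y + d y z"
    if "x \<in> carrier G" "y \<in> carrier G" "z \<in> carrier G" for x y z
  proof -
    have "enat (the_enat (graph_dist adj (p x) (p z))) \<le>
        enat (the_enat (graph_dist adj (p x) (p y))) + enat (the_enat (graph_dist adj (p y) (p z)))"
      using that by (simp add: enat_dist graph_dist_triangle)
    then show ?thesis
      unfolding d_def by simp
  qed
  have p_mult: "p (g \<otimes> x) = map_prod (\<lambda>C. g <# C) id (p x)"
    if "g \<in> carrier G" "x \<in> carrier G" for g x
    using that f by (simp add: p_def translate_lcoset m_assoc)
  have inv_le: "graph_dist adj (p (g \<otimes> x)) (p (g \<otimes> y)) \<le> graph_dist adj (p x) (p y)"
    if "g \<in> carrier G" "x \<in> carrier G" "y \<in> carrier G" for g x y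
    unfolding p_mult[OF that(1,2)] p_mult[OF that(1,3)]
    by (rule graph_dist_map_le) (rule translate_adj[OF that(1)])
  have inv: "d (g \<otimes> x) (g \<otimes> y) = d x y"
    if "g \<in> carrier G" "x \<in> carrier G" "y \<in> carrier G" for g x y
  proof -
    \<comment> \<open>Translating back by \<open>inv g\<close> gives the reverse of
      \<open>inv_le\<close>.\<close>
    have "inv g \<otimes> (g \<otimes> x) = x" "inv g \<otimes> (g \<otimes> y) = y"
      using that by (auto simp: m_assoc[symmetric])
    then have "graph_dist adj (p x) (p y) \<le> graph_dist adj (p (g \<otimes> x)) (p (g \<otimes> y))"
      using inv_le[of "inv g" "g \<otimes> x" "g \<otimes> y"] that by simp
    with inv_le[OF that] show ?thesis
      by (simp add: d_def)
  qed
  \<comment> \<open>For \<open>x\<close> in the group this is the coset of the conjugate of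
    \<open>H\<close> by \<open>f\<close> containing \<open>x\<close>: the points with the same orbit
    point as \<open>x\<close>. It is open as the preimage of \<open>H\<close> under a continuous
    map.\<close>
  define W where "W x = {x' \<in> topspace T. inv (x \<otimes> f) \<otimes> (x' \<otimes> f) \<in> H}" for x
  have mult_cont: "continuous_map T T (\<lambda>y. a y \<otimes> b y)"
    if "continuous_map T T a" "continuous_map T T b" for a b
    using continuous_map_compose[OF continuous_map_pairedI[OF that] continuous_mult]
    by (simp add: o_def)
  have W_open: "openin T (W x)" if "x \<in> carrier G" for x
    unfolding W_def using openin_H
    by (rule openin_continuous_map_preimage[rotated])
      (use f that in \<open>intro mult_cont; simp add: topspace_eq\<close>)
  have W_self: "x \<in> W x" if "x \<in> carrier G" for x
    using that f subgroup.one_closed[OF subgroup_H] by (simp add: W_def topspace_eq)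
  have W_eq: "p x' = p x" if "x \<in> carrier G" "x' \<in> W x" for x x'
    using that f lcoset_eqI[of "x \<otimes> f" "x' \<otimes> f"] by (simp add: W_def p_def topspace_eq)
  have cont: "continuous_map (prod_topology T T) euclideanreal (\<lambda>(x, y). d x y)"
    unfolding continuous_map
  proof (intro conjI allI impI)
    fix U :: "real set"
    let ?P = "{z \<in> topspace (prod_topology T T). (case z of (x, y) \<Rightarrow> d x y) \<in> U}"
    show "openin (prod_topology T T) ?P"
    \<comment> \<open>Around each of its points \<open>?P\<close> contains a box
      \<open>W x \<times> W y\<close>, because \<open>d\<close> is constant there.\<close>
    proof (subst openin_subopen, intro ballI)
      fix z assume z: "z \<in> ?P"
      obtain x y where xy: "z = (x, y)" "x \<in> carrier G" "y \<in> carrier G"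
        using z by (auto simp: topspace_eq)
      show "\<exists>V. openin (prod_topology T T) V \<and> z \<in> V \<and> V \<subseteq> ?P"
      proof (intro exI conjI)
        show "openin (prod_topology T T) (W x \<times> W y)"
          using xy W_open by (simp add: openin_prod_Times_iff)
        show "z \<in> W x \<times> W y"
          using xy W_self by simp
        show "W x \<times> W y \<subseteq> ?P"
          using z xy W_eq by (auto simp: d_def) (auto simp: W_def)
      qed
    qed
  qed auto
  show "left_inv_pseudometric G T d"
    unfolding left_inv_pseudometric_def
  proof (intro conjI ballI)
    show "d x x = 0" for x
      by (simp add: d_def graph_dist_refl zero_enat_def)
    show "d x y = d y x" for x y
      by (simp add: d_def graph_dist_sym[OF sym_adj, of "p x"])
  qed (use tri inv cont in \<open>simp_all add: d_def\<close>)
qed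

section \<open>Bounding group distances along walks\<close>

text \<open>Supplies coset representatives along a walk. The second case comes from horizontal edges
  read backwards; targets are covered by symmetry of \<open>adj\<close>.\<close>

lemma adj_source_lcoset: "(u, v) \<in> adj \<Longrightarrow> \<exists>f\<in>carrier G. fst u = f <# H"
proof -
  assume "(u, v) \<in> adj"
  then consider f k where "f \<in> carrier G" "u = (f <# H, k)"
    | f h i k where "f \<in> carrier G" "h \<in> H" "1 \<le> i" "u = ((f \<otimes> h \<otimes> s i) <# H, k)"
    unfolding tree_adj_def Let_def vertical_edges_def horizontal_edges_def by blast
  then show "\<exists>f\<in>carrier G. fst u = f <# H"
  proof cases
    case 1
    then show ?thesis
      by auto
  next
    case 2
    then have "f \<otimes> h \<otimes> s i \<in> carrier G"
      using H_sub s_closed by blast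
    with 2 show ?thesis
      by auto
  qed
qed

text \<open>Left translation by \<open>f\<close> carries \<open>H\<close> onto
  \<open>f <# H\<close>, so one bound serves all cosets.\<close>

lemma lcoset_diameter:
  assumes d: "left_inv_pseudometric G T d"
    and M: "\<And>a b. a \<in> H \<Longrightarrow> b \<in> H \<Longrightarrow> d a b \<le> M"
    and f: "f \<in> carrier G" and xy: "x \<in> f <# H" "y \<in> f <# H"
  shows "d x y \<le> M"
proof -
  obtain a b where ab: "a \<in> H" "x = f \<otimes> a" "b \<in> H" "y = f \<otimes> b"
    using xy unfolding l_coset_def by blast
  then have "d x y = d a b"
    using d f H_sub unfolding left_inv_pseudometric_def by blast
  with M ab show ?thesis
    by simp
qed

text \<open>A vertical edge keeps the coset. Along a horizontal edge, pass from \<open>x\<close> to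
  \<open>f \<otimes> h\<close> inside the first coset, then to
  \<open>f \<otimes> h \<otimes> s i\<close> at cost \<open>d \<one> (s i)\<close>, then to
  \<open>y\<close> inside the second: at most \<open>M + B + M\<close>. The cap \<open>N\<close> on
  the level limits which \<open>s i\<close> can occur.\<close>

lemma adj_bound:
  assumes d: "left_inv_pseudometric G T d"
    and M: "\<And>a b. a \<in> H \<Longrightarrow> b \<in> H \<Longrightarrow> d a b \<le> M"
    and B: "\<And>i. 1 \<le> i \<Longrightarrow> i \<le> N \<Longrightarrow> d \<one> (s i) \<le> B" "0 \<le> B"
    and uv: "(u, v) \<in> adj" and N: "snd u \<le> N"
    and xy: "x \<in> fst u" "y \<in> fst v"
  shows "d x y \<le> 2 * M + B" and "snd v \<le> Suc (snd u)"
proof -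
  have sym: "d x y = d y x" if "x \<in> carrier G" "y \<in> carrier G" for x y
    using d that unfolding left_inv_pseudometric_def by blast
  have tri: "d x z \<le> d x y + d y z"
    if "x \<in> carrier G" "y \<in> carrier G" "z \<in> carrier G" for x y z
    using d that unfolding left_inv_pseudometric_def by blast
  have inv: "d (g \<otimes> x) (g \<otimes> y) = d x y"
    if "g \<in> carrier G" "x \<in> carrier G" "y \<in> carrier G" for g x y
    using d that unfolding left_inv_pseudometric_def by blast
  note coset = lcoset_diameter[of d M, OF d M]
  have one: "\<one> \<in> H"
    using subgroup.one_closed[OF subgroup_H] .
  have "0 \<le> M"
    using d M[OF one one] unfolding left_inv_pseudometric_def by simp
  have in_coset: "x \<in> x <# H" if "x \<in> carrier G" for x
    using that one unfolding l_coset_def by force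
  have vertical: "d x y \<le> 2 * M + B"
    if uv: "(u, v) \<in> vertical_edges G H" and xy: "x \<in> fst u" "y \<in> fst v" for u v x y
  proof -
    obtain f k where "u = (f <# H, k)" "v = (f <# H, k + 1)" "f \<in> carrier G"
      using uv unfolding vertical_edges_def by blast
    with coset[of f x y] xy \<open>0 \<le> M\<close> \<open>0 \<le> B\<close> show ?thesis
      by simp
  qed
  \<comment> \<open>Membership in the carrier is recorded because a reversed edge later requires
    symmetry of \<open>d\<close> at \<open>x\<close> and \<open>y\<close>.\<close>
  have horizontal: "d x y \<le> 2 * M + B \<and> x \<in> carrier G \<and> y \<in> carrier G"
    if uv: "(u, v) \<in> horizontal_edges G H s"
      and N: "snd u \<le> N" and xy: "x \<in> fst u" "y \<in> fst v" for u v x y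
  proof -
    obtain f h i k where *: "u = (f <# H, k)" "v = ((f \<otimes> h \<otimes> s i) <# H, k)"
      "f \<in> carrier G" "h \<in> H" "1 \<le> i" "i \<le> k"
      using uv unfolding horizontal_edges_def by blast
    then have c: "f \<otimes> h \<in> carrier G" "s i \<in> carrier G" "f \<otimes> h \<otimes> s i \<in> carrier G"
      using H_sub s_closed by auto
    have xy_c: "x \<in> carrier G" "y \<in> carrier G"
      using xy * c l_coset_subset_G[OF H_sub] by auto
    have "d x (f \<otimes> h) \<le> M"
      using coset * xy in_coset[OF c(1)] by (simp add: lcoset_mult_H)
    moreover have "d (f \<otimes> h) (f \<otimes> h \<otimes> s i) \<le> B"
      using inv[OF c(1) one_closed c(2)] c(1) B(1) * N by simp
    moreover have "d (f \<otimes> h \<otimes> s i) y \<le> M"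
      using coset * xy in_coset[OF c(3)] c(3) by simp
    ultimately show ?thesis
      using xy_c tri[OF xy_c(1) c(1) xy_c(2)] tri[OF c(1) c(3) xy_c(2)] by auto
  qed
  have snd_h: "snd u = snd v" if "(u, v) \<in> horizontal_edges G H s" for u v
    using that unfolding horizontal_edges_def by auto
  have fst_v: "fst u = fst v" "snd v = Suc (snd u)" if "(u, v) \<in> vertical_edges G H" for u v
    using that unfolding vertical_edges_def by auto
  consider "(u, v) \<in> vertical_edges G H" | "(v, u) \<in> vertical_edges G H"
    | "(u, v) \<in> horizontal_edges G H s" | "(v, u) \<in> horizontal_edges G H s"
    using uv unfolding tree_adj_def Let_def by blast
  then have "d x y \<le> 2 * M + B \<and> snd v \<le> Suc (snd u)"
  proof cases
    case 1
    then show ?thesis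
      using vertical xy fst_v by auto
  next
    case 2
    then show ?thesis
      using vertical xy fst_v by auto
  next
    case 3
    then show ?thesis
      using horizontal[OF 3 N xy] snd_h by auto
  next
    case 4
    then show ?thesis
      using horizontal[OF 4 _ xy(2,1)] N sym[of x y] snd_h[OF 4] by auto
  qed
  then show "d x y \<le> 2 * M + B" "snd v \<le> Suc (snd u)"
    by auto
qed

text \<open>Induction on the length. The leading \<open>M\<close> pays for two points of the same
  coset when the walk is trivial. The level bound is carried along so that each edge starts at level
  at most \<open>N\<close>, as \<open>adj_bound\<close> demands.\<close>

lemma walk_bound:
  assumes d: "left_inv_pseudometric G T d"
    and M: "\<And>a b. a \<in> H \<Longrightarrow> b \<in> H \<Longrightarrow> d a b \<le> M"
    and B: "\<And>i. 1 \<le> i \<Longrightarrow> i \<le> N \<Longrightarrow> d \<one> (s i) \<le> B" "0 \<le> B"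
    and f: "f \<in> carrier G" and x: "x \<in> f <# H"
    and "((f <# H, k), v) \<in> adj ^^ n" "k + n \<le> N" "y \<in> fst v"
  shows "d x y \<le> M + real n * (2 * M + B) \<and> y \<in> carrier G \<and> snd v \<le> k + n"
  using assms(7-)
proof (induction n arbitrary: v y)
  case 0
  then have "y \<in> f <# H" "v = (f <# H, k)"
    by auto
  then show ?case
    using lcoset_diameter[of d M, OF d M f x] subsetD[OF l_coset_subset_G[OF H_sub f]] by simp
next
  case (Suc n)
  then obtain w where w: "((f <# H, k), w) \<in> adj ^^ n" "(w, v) \<in> adj"
    by auto
  obtain f' where f': "f' \<in> carrier G" "fst w = f' <# H"
    using adj_source_lcoset[OF w(2)] by blast
  obtain f'' where f'': "f'' \<in> carrier G" "fst v = f'' <# H"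
    using adj_source_lcoset[OF symD[OF sym_adj w(2)]] by blast
  \<comment> \<open>The representative \<open>f'\<close> of the last intermediate coset is the relay
    point for the triangle inequality.\<close>
  have z: "f' \<in> fst w"
    using f' subgroup.one_closed[OF subgroup_H] unfolding l_coset_def by force
  have IH: "d x f' \<le> M + real n * (2 * M + B)" "snd w \<le> k + n"
    using Suc.IH[OF w(1) _ z] Suc.prems by auto
  have step: "d f' y \<le> 2 * M + B" "snd v \<le> Suc (snd w)"
    using adj_bound[OF d M B w(2) _ z Suc.prems(3)] IH(2) Suc.prems(2) by auto
  have c: "x \<in> carrier G" "y \<in> carrier G"
    using x f f'' Suc.prems(3) l_coset_subset_G[OF H_sub] by auto
  have "d x y \<le> d x f' + d f' y"
    using d c f' unfolding left_inv_pseudometric_def by blast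
  with IH step c show ?case
    by (auto simp: algebra_simps)
qed

section \<open>The orbit map is a coarse equivalence\<close>

theorem orbit_map_coarse_equivalence:
  assumes gen: "generate G (H \<union> s ` {1..}) = carrier G"
    and cb: "coarsely_bounded G T H"
    and v: "v \<in> tree_verts G H"
  shows "coarse_equivalence (carrier G) (left_entourages G T) (orbit G (tree_act G H) v)
    (metric_entourages (orbit G (tree_act G H) v) (graph_dist adj)) (\<lambda>g. tree_act G H g v)"
proof -
  obtain f k where f: "f \<in> carrier G" and k: "1 \<le> k" and v_eq: "v = (f <# H, k)"
    using v unfolding tree_verts_def LCOSETS_def by auto
  \<comment> \<open>All orbit points share the level \<open>k\<close> of \<open>v\<close>, and
    \<open>f\<close> represents its coset.\<close>
  have act: "tree_act G H g v = ((g \<otimes> f) <# H, k)" if "g \<in> carrier G" for g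
    using that v f by (simp add: tree_act_def v_eq translate_lcoset)
  let ?Y = "orbit G (tree_act G H) v"
  let ?p = "\<lambda>g. tree_act G H g v"
  have in_orbit: "?p g \<in> ?Y" if "g \<in> carrier G" for g
    using that unfolding orbit_def by blast
  have "?p \<in> carrier G \<rightarrow> ?Y"
    using in_orbit by blast
  moreover have "bornologous (left_entourages G T) (metric_entourages ?Y (graph_dist adj)) ?p"
    unfolding bornologous_def
  proof
    fix E assume E: "E \<in> left_entourages G T"
    then have sub: "E \<subseteq> carrier G \<times> carrier G"
      unfolding left_entourages_def by blast
    \<comment> \<open>An entourage is bounded for every admissible pseudometric; it is tested on the
      orbit distance itself.\<close>
    note pseudo = orbit_pseudometric[OF gen f k]
    obtain C where C: "\<And>g h. (g, h) \<in> E \<Longrightarrow>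
        real (the_enat (graph_dist adj ((g \<otimes> f) <# H, k) ((h \<otimes> f) <# H, k))) \<le> C"
      using E pseudo(1) unfolding left_entourages_def bdd_above_def by force
    obtain n :: nat where "C \<le> real n"
      using real_arch_simple by blast
    have "graph_dist adj (?p g) (?p h) \<le> enat n" if gh: "(g, h) \<in> E" for g h
    proof -
      have c: "g \<in> carrier G" "h \<in> carrier G"
        using gh sub by auto
      show ?thesis
        unfolding act[OF c(1)] act[OF c(2)]
        using C[OF gh] \<open>C \<le> real n\<close> by (intro pseudo(2)[OF c]) linarith
    qed
    then have "\<forall>(a, b)\<in>map_prod ?p ?p ` E. graph_dist adj a b \<le> enat n"
      unfolding ball_simps by (simp add: case_prod_beta)
    moreover have "map_prod ?p ?p ` E \<subseteq> ?Y \<times> ?Y"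
      using sub in_orbit by auto
    ultimately show "map_prod ?p ?p ` E \<in> metric_entourages ?Y (graph_dist adj)"
      unfolding metric_entourages_def by blast
  qed
  moreover have "expanding (carrier G) (left_entourages G T)
    (metric_entourages ?Y (graph_dist adj)) ?p"
    unfolding expanding_def
  proof
    fix F assume "F \<in> metric_entourages ?Y (graph_dist adj)"
    then obtain n where n: "\<And>a b. (a, b) \<in> F \<Longrightarrow> graph_dist adj a b \<le> enat n"
      unfolding metric_entourages_def by blast
    let ?E = "map_prod ?p ?p -` F \<inter> carrier G \<times> carrier G"
    have "bdd_above ((\<lambda>(g, h). d g h) ` ?E)" if d: "left_inv_pseudometric G T d" for d
    proof -
      have nonneg: "0 \<le> d x y" and sym: "d x y = d y x"
        if "x \<in> carrier G" "y \<in> carrier G" for x y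
        using d that unfolding left_inv_pseudometric_def by blast+
      have tri: "d x z \<le> d x y + d y z"
        if "x \<in> carrier G" "y \<in> carrier G" "z \<in> carrier G" for x y z
        using d that unfolding left_inv_pseudometric_def by blast
      \<comment> \<open>Left invariance makes right multiplication by \<open>f\<close> a
        displacement of constant size, so \<open>g\<close> and \<open>h\<close> may be replaced by
        the representatives \<open>g \<otimes> f\<close> and \<open>h \<otimes> f\<close>.\<close>
      have shift: "d x (x \<otimes> f) = d \<one> f" if "x \<in> carrier G" for x
        using d that f unfolding left_inv_pseudometric_def by (metis one_closed r_one)
      obtain M where M: "\<And>a b. a \<in> H \<Longrightarrow> b \<in> H \<Longrightarrow> d a b \<le> M"
        using cb d unfolding coarsely_bounded_def bdd_above_def by force
      have one: "\<one> \<in> H"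
        using subgroup.one_closed[OF subgroup_H] .
      have "0 \<le> M"
        using nonneg[of \<one> \<one>] M[OF one one] by simp
      \<comment> \<open>A walk of length at most \<open>n\<close> from level \<open>k\<close> meets
        no level above \<open>k + n\<close>. The sum is a convenient common bound for the finitely
        many nonnegative distances involved.\<close>
      define B where "B = (\<Sum>i = 1..k + n. d \<one> (s i))"
      have B: "d \<one> (s i) \<le> B" if "1 \<le> i" "i \<le> k + n" for i
        unfolding B_def using that nonneg s_closed by (intro member_le_sum) auto
      have "0 \<le> B"
        unfolding B_def using nonneg s_closed by (intro sum_nonneg) auto
      have "d g h \<le> 2 * d \<one> f + (M + real n * (2 * M + B))" if gh: "(g, h) \<in> ?E" for g h
      proof -
        have c: "g \<in> carrier G" "h \<in> carrier G" "g \<otimes> f \<in> carrier G" "h \<otimes> f \<in> carrier G"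
          using gh f by auto
        have "graph_dist adj (?p g) (?p h) \<le> enat n"
          using gh n by auto
        then obtain m where m: "m \<le> n" "(((g \<otimes> f) <# H, k), ((h \<otimes> f) <# H, k)) \<in> adj ^^ m"
          unfolding graph_dist_le_iff act[OF c(1)] act[OF c(2)] by blast
        have in_coset: "x \<in> x <# H" if "x \<in> carrier G" for x
          using that one unfolding l_coset_def by force
        \<comment> \<open>The walk has some length \<open>m\<close> at most \<open>n\<close>;
          monotonicity in the length then gives a bound independent of the pair.\<close>
        have "d (g \<otimes> f) (h \<otimes> f) \<le> M + real m * (2 * M + B)"
          using walk_bound[OF d M B \<open>0 \<le> B\<close> c(3) in_coset[OF c(3)] m(2)] m(1) in_coset[OF c(4)]
          by auto
        also have "\<dots> \<le> M + real n * (2 * M + B)"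
          using m(1) \<open>0 \<le> M\<close> \<open>0 \<le> B\<close> by (intro add_left_mono mult_right_mono) auto
        finally have "d (g \<otimes> f) (h \<otimes> f) \<le> M + real n * (2 * M + B)" .
        moreover have "d g h \<le> d g (g \<otimes> f) + (d (g \<otimes> f) (h \<otimes> f) + d (h \<otimes> f) h)"
          using tri[OF c(1) c(3) c(2)] tri[OF c(3) c(4) c(2)] by simp
        moreover have "d (h \<otimes> f) h = d \<one> f"
          using sym c shift by metis
        ultimately show ?thesis
          using shift[OF c(1)] by simp
      qed
      then show ?thesis
        by (intro bdd_aboveI2[where M = "2 * d \<one> f + (M + real n * (2 * M + B))"])
          (clarsimp split: prod.split)
    qed
    then show "?E \<in> left_entourages G T"
      unfolding left_entourages_def by blast
  qed
  moreover have "cobounded (carrier G) ?Y (metric_entourages ?Y (graph_dist adj)) ?p"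
    unfolding cobounded_def
  proof
    \<comment> \<open>The orbit map is onto the orbit, so the diagonal is a sufficient
      entourage.\<close>
    show "Id_on ?Y \<in> metric_entourages ?Y (graph_dist adj)"
      unfolding metric_entourages_def by (auto simp: graph_dist_refl)
    show "\<forall>y\<in>?Y. \<exists>x\<in>carrier G. (y, ?p x) \<in> Id_on ?Y"
      unfolding orbit_def by blast
  qed
  ultimately show ?thesis
    unfolding coarse_equivalence_def by blast
qed

end

theorem proposition5p4:
  fixes G (structure) and T :: "'a topology" and H S :: "'a set"
    and s :: "nat \<Rightarrow> 'a" and v :: "'a set \<times> nat"
  assumes "topological_group G T"
    and "subgroup H G" and "openin T H" and "coarsely_bounded G T H"
    and "S \<subseteq> carrier G" and "bij_betw s {1..} S"
    and "generate G (H \<union> S) = carrier G"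
    and "\<And>k. 1 \<le> k \<Longrightarrow> generate G (H \<union> s ` {1..k}) \<subset> carrier G"
    and "v \<in> tree_verts G H"
  shows "coarse_equivalence
           (carrier G) (left_entourages G T)
           (orbit G (tree_act G H) v)
           (metric_entourages (orbit G (tree_act G H) v) (graph_dist (tree_adj G H s)))
           (\<lambda>g. tree_act G H g v)"
proof -
  \<comment> \<open>Rewrites generation by \<open>H\<close> and \<open>S\<close> in terms of the
    sequence, as the locale results expect.\<close>
  have S: "S = s ` {1..}"
    using assms(6) by (simp add: bij_betw_imp_surj_on)
  interpret topological_group G T
    by fact
  interpret tree_of_graphs G T H s
  proof (intro tree_of_graphs.intro tree_of_graphs_axioms.intro)
    show "s i \<in> carrier G" if "1 \<le> i" for i
      using assms(5) that unfolding S by auto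
  qed (fact assms)+
  show ?thesis
    by (rule orbit_map_coarse_equivalence[OF assms(7)[unfolded S] assms(4,9)])
qed

end
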